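(* Suppose that $f:\mathbb{R}^n\to(-\infty,\infty]$ is a proper closed function that is prox-regular at $\bar x$ and $\mathcal{C}^2$-partly smooth at $\bar x$ relative to a manifold $\mathfrak{M}$. Suppose further that $0\in\mathrm{ri}\,\partial f(\bar x)$ and that there exist $c,\nu,\epsilon>0$ and $\alpha\in[0,1)$ such that $$\|\nabla_{\mathfrak{M}}f(x)\|\ge c\,(f(x)-f(\bar x))^\alpha$$ whenever $x\in\mathfrak{M}$ with $\|x-\bar x\|\le\epsilon$ and $f(\bar x)<f(x)<f(\bar x)+\nu$. Then $f$ has the KL property at $\bar x$ with an exponent of $\alpha$.
   Context: Closed means lower semicontinuous; proper means never $-\infty$ and not identically $+\infty$; $\mathrm{dom}\,f=\{x: f(x)<\infty\}$; $\mathrm{ri}$ denotes relative interior. For a proper function $f$ and $x\in\mathrm{dom}\,f$, the regular subdifferential is $\widehat\partial f(x)=\{v: \liminf_{z\to x,z\ne x}\frac{f(z)-f(x)-\langle v,z-x\rangle}{\|z-x\|}\ge 0\}$ and the (limiting) subdifferential $\partial f(x)$ is the set of $v$ for which there exist $x^t\to x$ with $f(x^t)\to f(x)$ and $v^t\to v$ with $v^t\in\widehat\partial f(x^t)$ for each $t$; $\partial f(x)=\emptyset$ if $x\notin\mathrm{dom}\,f$. $\mathrm{dom}\,\partial f=\{x:\partial f(x)\ne\emptyset\}$. For a closed set $S$ and $x\in S$, the limiting and regular normal cones are $N_S(x)=\partial\delta_S(x)$ and $\widehat N_S(x)=\widehat\partial\delta_S(x)$, with $\delta_S$ the indicator function;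 $S$ is regular at $x$ if $N_S(x)=\widehat N_S(x)$, and $f$ is regular at $x\in\mathrm{dom}\,f$ if its epigraph is regular at $(x,f(x))$. Prox-regularity: $f$ is prox-regular at $\bar x\in\mathrm{dom}\,f$ for $\bar v\in\partial f(\bar x)$ if there exists $\rho\ge0$ such that $f(x')\ge f(x)+\langle v,x'-x\rangle-\frac{\rho}{2}\|x'-x\|^2$ whenever $x$ and $x'$ are near $\bar x$ with $f(x)$ near $f(\bar x)$ and $v\in\partial f(x)$ is near $\bar v$; $f$ is prox-regular at $\bar x$ if it is so for every $\bar v\in\partial f(\bar x)$. $\mathfrak{M}$ is a $\mathcal{C}^2$ manifold about $\bar x\in\mathfrak{M}$: locally it is the solution set of a collection of $\mathcal{C}^2$ equations with linearly independent gradients. Let $P_{\mathfrak{M}}$ be the projection onto $\mathfrak{M}$ (well defined near $\bar x$) and $T_x(\mathfrak{M})$ the tangent space at $x$. The covariant derivative $\nabla_{\mathfrak{M}}f(x)$, for $x\in\mathfrak{M}$ around which $f$ is $\mathcal{C}^2$ along $\mathfrak{M}$, is the unique vector in $T_x(\mathfrak{M})$ with $\langle\nabla_{\mathfrak{M}}f(x),\xi\rangle=\frac{d}{dt}f(P_{\mathfrak{M}}(x+t\xi))\big|_{t=0}$ for all $\xi\in T_x(\mathfrak{M})$. Partial smoothness: $f$ is $\mathcal{C}^2$-partly smooth at $\bar x$ relative to $\mathfrak{M}$ if (i) the restriction of $f$ to $\mathfrak{M}$ is a $\mathcal{C}^2$ function near $\bar x$; (ii) at every point in $\mathfrak{M}$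 close to $\bar x$, $f$ is regular, and $\partial f(\bar x)\neq\emptyset$; (iii) the affine span of $\partial f(\bar x)$ is a translate of $N_{\mathfrak{M}}(\bar x)$; (iv) the subdifferential mapping $\partial f$ restricted to $\mathfrak{M}$ is continuous at $\bar x$. KL property: a proper closed function $f$ has the KL property at $\bar x\in\mathrm{dom}\,\partial f$ with an exponent of $\alpha\in[0,1)$ if there exist $c,\epsilon>0$ and $\nu\in(0,\infty]$ such that $\mathrm{dist}(0,\partial f(x))\ge c\,(f(x)-f(\bar x))^\alpha$ whenever $\|x-\bar x\|\le\epsilon$ and $f(\bar x)<f(x)<f(\bar x)+\nu$ (with $\mathrm{dist}(0,\emptyset)=+\infty$). *)

theory Defs
  imports "HOL-Analysis.Analysis"
begin

definition proper_fun :: "('a \<Rightarrow> ereal) \<Rightarrow> bool" where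
  "proper_fun f \<longleftrightarrow> (\<forall>x. f x \<noteq> -\<infinity>) \<and> (\<exists>x. f x \<noteq> \<infinity>)"

definition closed_fun :: "('a::topological_space \<Rightarrow> ereal) \<Rightarrow> bool" where
  "closed_fun f \<longleftrightarrow> (\<forall>x. f x \<le> Liminf (at x) f)"

definition edom :: "('a \<Rightarrow> ereal) \<Rightarrow> 'a set" where
  "edom f = {x. f x < \<infinity>}"

definition epi :: "('a \<Rightarrow> ereal) \<Rightarrow> ('a \<times> real) set" where
  "epi f = {(x, r). f x \<le> ereal r}"

definition delta_fun :: "'a set \<Rightarrow> 'a \<Rightarrow> ereal" where
  "delta_fun S x = (if x \<in> S then 0 else \<infinity>)"

text \<open>The filter \<open>at x\<close> excludes \<open>x\<close> itself, so the quotient is never evaluated at \<open>z = x\<close>.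
  These notions are meant for functions that do not take the value \<open>-\<infinity>\<close>; then
  \<open>f x\<close> is finite for \<open>x \<in> edom f\<close> and no \<open>\<infinity> - \<infinity>\<close> arises.\<close>

definition regular_subdiff :: "('a::euclidean_space \<Rightarrow> ereal) \<Rightarrow> 'a \<Rightarrow> 'a set" where
  "regular_subdiff f x =
     {v. x \<in> edom f \<and>
         0 \<le> Liminf (at x) (\<lambda>z. (f z - f x - ereal (v \<bullet> (z - x))) / ereal (norm (z - x)))}"

definition subdiff :: "('a::euclidean_space \<Rightarrow> ereal) \<Rightarrow> 'a \<Rightarrow> 'a set" where
  "subdiff f x =
     {v. x \<in> edom f \<and>
         (\<exists>xs vs. xs \<longlonglongrightarrow> x \<and> (\<lambda>t. f (xs t)) \<longlonglongrightarrow> f x \<and> vs \<longlonglongrightarrow> v \<and>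
                  (\<forall>t::nat. vs t \<in> regular_subdiff f (xs t)))}"

definition dom_subdiff :: "('a::euclidean_space \<Rightarrow> ereal) \<Rightarrow> 'a set" where
  "dom_subdiff f = {x. subdiff f x \<noteq> {}}"

definition normal_cone :: "'a::euclidean_space set \<Rightarrow> 'a \<Rightarrow> 'a set" where
  "normal_cone S x = subdiff (delta_fun S) x"

definition regular_normal_cone :: "'a::euclidean_space set \<Rightarrow> 'a \<Rightarrow> 'a set" where
  "regular_normal_cone S x = regular_subdiff (delta_fun S) x"

definition regular_set_at :: "'a::euclidean_space set \<Rightarrow> 'a \<Rightarrow> bool" where
  "regular_set_at S x \<longleftrightarrow> x \<in> S \<and> normal_cone S x = regular_normal_cone S x"

definition regular_fun_at :: "('a::euclidean_space \<Rightarrow> ereal) \<Rightarrow> 'a \<Rightarrow> bool" where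
  "regular_fun_at f x \<longleftrightarrow> x \<in> edom f \<and> regular_set_at (epi f) (x, real_of_ereal (f x))"

definition prox_regular_at_for :: "('a::euclidean_space \<Rightarrow> ereal) \<Rightarrow> 'a \<Rightarrow> 'a \<Rightarrow> bool" where
  "prox_regular_at_for f xb vb \<longleftrightarrow>
     xb \<in> edom f \<and> vb \<in> subdiff f xb \<and>
     (\<exists>\<rho>\<ge>0. \<exists>\<delta>>0. \<forall>x x' v.
        norm (x - xb) < \<delta> \<and> norm (x' - xb) < \<delta> \<and> \<bar>f x - f xb\<bar> < ereal \<delta> \<and>
        v \<in> subdiff f x \<and> norm (v - vb) < \<delta>
        \<longrightarrow> f x' \<ge> f x + ereal (v \<bullet> (x' - x) - \<rho> / 2 * (norm (x' - x))\<^sup>2))"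

definition prox_regular_at :: "('a::euclidean_space \<Rightarrow> ereal) \<Rightarrow> 'a \<Rightarrow> bool" where
  "prox_regular_at f xb \<longleftrightarrow>
     xb \<in> edom f \<and> (\<forall>vb\<in>subdiff f xb. prox_regular_at_for f xb vb)"

definition C2_with_gradient_on ::
    "('a::euclidean_space \<Rightarrow> real) \<Rightarrow> ('a \<Rightarrow> 'a) \<Rightarrow> 'a set \<Rightarrow> bool" where
  "C2_with_gradient_on g G U \<longleftrightarrow>
     (\<forall>x\<in>U. GDERIV g x :> G x) \<and>
     (\<exists>H :: 'a \<Rightarrow> 'a \<Rightarrow>\<^sub>L 'a.
        (\<forall>x\<in>U. (G has_derivative blinfun_apply (H x)) (at x)) \<and> continuous_on U H)"

text \<open>Injectivity is needed because \<open>independent\<close> speaks about a set, not a family, of vectors.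
  The case \<open>m = 0\<close> (an open piece of the space) is allowed.\<close>

definition C2_manifold_about :: "'a::euclidean_space set \<Rightarrow> 'a \<Rightarrow> bool" where
  "C2_manifold_about M xb \<longleftrightarrow>
     xb \<in> M \<and>
     (\<exists>U (m::nat) g G.
        open U \<and> xb \<in> U \<and>
        (\<forall>i<m. C2_with_gradient_on (g i) (G i) U) \<and>
        M \<inter> U = {x \<in> U. \<forall>i<m. g i x = 0} \<and>
        (\<forall>x\<in>U. inj_on (\<lambda>i. G i x) {..<m} \<and> independent ((\<lambda>i. G i x) ` {..<m})))"

text \<open>Velocities at \<open>x\<close> of curves in \<open>M\<close>; on the manifold part of \<open>M\<close> these form a subspace (the
  kernel of the gradients of the defining equations), which fails for general \<open>M\<close>.\<close>

definition tangent_space :: "'a::euclidean_space set \<Rightarrow> 'a \<Rightarrow> 'a set" where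
  "tangent_space M x =
     {\<xi>. \<exists>\<gamma> :: real \<Rightarrow> 'a. \<gamma> 0 = x \<and> (\<forall>\<^sub>F t in nhds 0. \<gamma> t \<in> M) \<and>
          (\<gamma> has_vector_derivative \<xi>) (at 0)}"

text \<open>Intended for \<open>x \<in> M\<close> around which \<open>M\<close> is a \<open>C\<^sup>2\<close> manifold and \<open>f\<close> is \<open>C\<^sup>2\<close> along
  \<open>M\<close>. Then \<open>closest_point M\<close> is single-valued near \<open>x\<close> and \<open>f\<close> is finite on \<open>M\<close> near \<open>x\<close>,
  so \<open>real_of_ereal\<close> loses nothing. Elsewhere the value is unspecified.\<close>

definition covariant_derivative :: "'a::euclidean_space set \<Rightarrow> ('a \<Rightarrow> ereal) \<Rightarrow> 'a \<Rightarrow> 'a" where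
  "covariant_derivative M f x =
     (THE g. g \<in> tangent_space M x \<and>
        (\<forall>\<xi>\<in>tangent_space M x.
           ((\<lambda>t. real_of_ereal (f (closest_point M (x + t *\<^sub>R \<xi>))))
              has_real_derivative (g \<bullet> \<xi>)) (at 0)))"

text \<open>\<open>f\<close> agrees on \<open>M\<close> near \<open>xb\<close> with a (finite) function that is \<open>C\<^sup>2\<close> near \<open>xb\<close>.\<close>

definition C2_along_at :: "('a::euclidean_space \<Rightarrow> ereal) \<Rightarrow> 'a set \<Rightarrow> 'a \<Rightarrow> bool" where
  "C2_along_at f M xb \<longleftrightarrow>
     (\<exists>U h G. open U \<and> xb \<in> U \<and> C2_with_gradient_on h G U \<and> (\<forall>x\<in>M \<inter> U. f x = ereal (h x)))"

text \<open>Painleve-Kuratowski continuity at \<open>xb\<close> relative to \<open>M\<close>: outer semicontinuity, then inner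
  semicontinuity.\<close>

definition setvalued_continuous_within ::
    "('a::euclidean_space \<Rightarrow> 'a set) \<Rightarrow> 'a \<Rightarrow> 'a set \<Rightarrow> bool" where
  "setvalued_continuous_within S xb M \<longleftrightarrow>
     (\<forall>xs vs v. (\<forall>t::nat. xs t \<in> M \<and> vs t \<in> S (xs t)) \<and> xs \<longlonglongrightarrow> xb \<and> vs \<longlonglongrightarrow> v
        \<longrightarrow> v \<in> S xb) \<and>
     (\<forall>v\<in>S xb. \<forall>xs. (\<forall>t::nat. xs t \<in> M) \<and> xs \<longlonglongrightarrow> xb
        \<longrightarrow> (\<exists>vs. (\<forall>\<^sub>F t in sequentially. vs t \<in> S (xs t)) \<and> vs \<longlonglongrightarrow> v))"

definition C2_partly_smooth ::
    "('a::euclidean_space \<Rightarrow> ereal) \<Rightarrow> 'a \<Rightarrow> 'a set \<Rightarrow> bool" where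
  "C2_partly_smooth f xb M \<longleftrightarrow>
     C2_manifold_about M xb \<and>
     C2_along_at f M xb \<and>
     (\<forall>\<^sub>F x in nhds xb. x \<in> M \<longrightarrow> regular_fun_at f x) \<and> subdiff f xb \<noteq> {} \<and>
     (\<exists>a. affine hull (subdiff f xb) = (\<lambda>w. a + w) ` normal_cone M xb) \<and>
     setvalued_continuous_within (subdiff f) xb M"

text \<open>The infimum is taken in \<open>ereal\<close>, so the distance to the empty set is \<open>\<infinity>\<close>
  (unlike for \<open>infdist\<close>, where it is 0).\<close>

definition edist_to :: "'a::metric_space \<Rightarrow> 'a set \<Rightarrow> ereal" where
  "edist_to x S = (INF y\<in>S. ereal (dist x y))"

text \<open>In the inequality \<open>f x - f xb\<close> is finite and positive, also if \<open>\<nu> = \<infinity>\<close>; in particular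
  its 0-th power is 1.\<close>

definition KL_property :: "('a::euclidean_space \<Rightarrow> ereal) \<Rightarrow> 'a \<Rightarrow> real \<Rightarrow> bool" where
  "KL_property f xb \<alpha> \<longleftrightarrow>
     proper_fun f \<and> closed_fun f \<and> xb \<in> dom_subdiff f \<and> 0 \<le> \<alpha> \<and> \<alpha> < 1 \<and>
     (\<exists>c>0. \<exists>\<epsilon>>0. \<exists>\<nu>::ereal. \<nu> > 0 \<and>
        (\<forall>x. norm (x - xb) \<le> \<epsilon> \<and> f xb < f x \<and> f x < f xb + \<nu>
           \<longrightarrow> edist_to 0 (subdiff f x) \<ge> ereal (c * real_of_ereal (f x - f xb) powr \<alpha>)))"

end

theory Submission
  imports Defs
begin

text \<open>
  Fix a subgradient \<open>v\<close> of \<open>f\<close> at a point \<open>x\<close> near \<open>xb\<close> where \<open>f x\<close> is slightly above \<open>f xb\<close>,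
  by less than \<open>1\<close>. If
  \<open>norm v\<close> is bounded below by a constant, the desired inequality is trivial, because
  \<open>(f x - f xb) powr \<alpha> \<le> 1\<close>. So only small \<open>v\<close> matter, and for them two facts combine.

  \<^item> \<^emph>\<open>Identification\<close> (\<open>small_subgradients_only_on_manifold\<close>): such an \<open>x\<close> must lie on \<open>M\<close>.
    Otherwise there are points \<open>x\<close> off \<open>M\<close> converging to \<open>xb\<close> with values converging to \<open>f xb\<close>
    and subgradients \<open>v\<close> converging to \<open>0\<close>. Let \<open>p\<close> be a nearest point of \<open>M\<close> and \<open>w = (x - p) / norm (x - p)\<close>. Along a subsequence
    \<open>w\<close> converges to a unit normal of \<open>M\<close> at \<open>xb\<close>. Since \<open>0\<close> is a relative interior point of
    \<open>subdiff f xb\<close>, whose affine hull is parallel to the normal cone, a small positive multiple of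
    that normal is a subgradient at \<open>xb\<close>, and inner semicontinuity along \<open>M\<close> yields nearby
    subgradients \<open>u\<close> at \<open>p\<close>. Thus \<open>f\<close> grows from \<open>p\<close> to \<open>x\<close> at a definite linear rate, while the
    prox-regularity inequality for \<open>v\<close> at \<open>x\<close> allows almost no linear growth.

  \<^item> \<^emph>\<open>Comparison\<close> (\<open>norm_covariant_derivative_le\<close>): on \<open>M\<close>, the prox-regularity inequality says
    that \<open>f\<close> has a quadratic lower model with slope \<open>v\<close> at \<open>x\<close>. Along curves in \<open>M\<close> this model
    touches the smooth restriction of \<open>f\<close> from below, so \<open>v\<close> and the covariant derivative have the
    same inner product with every tangent vector. The covariant derivative is therefore the
    tangential part of \<open>v\<close>, hence not longer than \<open>v\<close>.

  The second fact needs the covariant derivative, a definite description, to exist. This rests on the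
  tangent space, defined by velocities of curves, being a linear subspace
  (\<open>tangent_space_eq_kernel\<close>), which is where the inverse function theorem enters.
\<close>

section \<open>Tangent spaces of manifolds\<close>

lemma GDERIV_along_curve:
  fixes h :: "'a::real_inner \<Rightarrow> real"
  assumes "GDERIV h x :> D" "(\<gamma> has_vector_derivative \<xi>) (at 0)" "\<gamma> 0 = x"
  shows "((\<lambda>t. h (\<gamma> t)) has_real_derivative D \<bullet> \<xi>) (at 0)"
proof -
  have "((\<lambda>t. h (\<gamma> t)) has_derivative (\<lambda>t. (t *\<^sub>R \<xi>) \<bullet> D)) (at 0)"
    using assms has_derivative_compose[of \<gamma> "\<lambda>t. t *\<^sub>R \<xi>" 0 UNIV h "\<lambda>y. y \<bullet> D"]
    by (simp add: gderiv_def has_vector_derivative_def)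
  then show ?thesis
    by (simp add: has_field_derivative_def inner_commute mult.commute[of _ "\<xi> \<bullet> D"])
       (simp add: inner_commute mult_commute_abs)
qed

lemma dual_family_exists:
  fixes b :: "nat \<Rightarrow> 'a::euclidean_space"
  assumes "inj_on b {..<m}" "independent (b ` {..<m})"
  obtains c where "\<And>i j. i < m \<Longrightarrow> j < m \<Longrightarrow> b j \<bullet> c i = (if i = j then 1 else 0)"
proof -
  have "\<exists>c. \<forall>j<m. b j \<bullet> c = (if i = j then 1 else 0)" if i: "i < m" for i
  proof -
    obtain l :: "'a \<Rightarrow> real" where l: "linear l"
      and lb: "\<And>x. x \<in> b ` {..<m} \<Longrightarrow> l x = (if x = b i then 1 else 0)"
      using linear_independent_extend[OF assms(2), of "\<lambda>x. if x = b i then 1 else 0"] by blast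
    have "b j \<bullet> adjoint l 1 = (if i = j then 1 else 0)" if "j < m" for j
    proof -
      have "b j = b i \<longleftrightarrow> i = j"
        using assms(1) i that by (auto dest: inj_onD)
      then show ?thesis
        using lb[of "b j"] that adjoint_works[OF l, of "b j" 1] by (simp add: inner_commute)
    qed
    then show ?thesis by blast
  qed
  then obtain c where "\<And>i. i < m \<Longrightarrow> \<forall>j<m. b j \<bullet> c i = (if i = j then 1 else 0)"
    by metis
  then show thesis
    by (intro that) blast
qed

lemma gradient_field_continuous:
  fixes G :: "'a::euclidean_space \<Rightarrow> 'a"
  assumes "C2_with_gradient_on g G U"
  shows "continuous_on U G"
proof -
  obtain H :: "'a \<Rightarrow> 'a \<Rightarrow>\<^sub>L 'a" where "\<And>x. x \<in> U \<Longrightarrow> (G has_derivative blinfun_apply (H x)) (at x)"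
    using assms unfolding C2_with_gradient_on_def by auto
  then show ?thesis
    by (intro continuous_at_imp_continuous_on ballI has_derivative_continuous)
qed

lemma C2_function_continuous:
  assumes "C2_with_gradient_on g G U" "x \<in> U"
  shows "isCont g x"
proof -
  have "GDERIV g x :> G x"
    using assms unfolding C2_with_gradient_on_def by auto
  then show ?thesis
    unfolding gderiv_def by (rule has_derivative_continuous)
qed

text \<open>
  That a vector \<open>\<xi>\<close> in the kernel is a velocity is shown by straightening \<open>M\<close>: with \<open>b i = G i x\<close> and
  a dual family \<open>c\<close>, the map \<open>\<Phi> y = (y - x) - (\<Sum>i<m. (b i \<bullet> (y - x) - g i y) *\<^sub>R c i)\<close> has
  the identity as derivative at \<open>x\<close> and satisfies \<open>b j \<bullet> \<Phi> y = g j y\<close>. Hence its local inverse maps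
  the line \<open>t *\<^sub>R \<xi>\<close> to a curve in \<open>M\<close> with velocity \<open>\<xi>\<close>.
\<close>

lemma tangent_space_eq_kernel:
  fixes M :: "'a::euclidean_space set" and g :: "nat \<Rightarrow> 'a \<Rightarrow> real"
  assumes U: "open U" "x \<in> M" "x \<in> U"
    and C2: "\<And>i. i < m \<Longrightarrow> C2_with_gradient_on (g i) (G i) U"
    and MU: "M \<inter> U = {x \<in> U. \<forall>i<m. g i x = 0}"
    and ind: "inj_on (\<lambda>i. G i x) {..<m}" "independent ((\<lambda>i. G i x) ` {..<m})"
  shows "tangent_space M x = {\<xi>. \<forall>i<m. G i x \<bullet> \<xi> = 0}"
proof (intro set_eqI iffI)
  fix \<xi> assume "\<xi> \<in> tangent_space M x"
  then obtain \<gamma> where \<gamma>: "\<gamma> 0 = x" "\<forall>\<^sub>F t in nhds 0. \<gamma> t \<in> M"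
    "(\<gamma> has_vector_derivative \<xi>) (at 0)"
    unfolding tangent_space_def by blast
  have "(\<gamma> \<longlongrightarrow> x) (at 0)"
    using has_vector_derivative_continuous[OF \<gamma>(3)] \<gamma>(1) by (simp add: continuous_within)
  then have "\<forall>\<^sub>F t in at 0. \<gamma> t \<in> U"
    using U topological_tendstoD by blast
  then have "\<forall>\<^sub>F t in nhds 0. \<gamma> t \<in> U"
    using \<gamma>(1) U by (simp add: eventually_nhds_conv_at)
  with \<gamma>(2) have inMU: "\<forall>\<^sub>F t in nhds 0. \<gamma> t \<in> M \<inter> U"
    by eventually_elim simp
  have "G i x \<bullet> \<xi> = 0" if i: "i < m" for i
  proof -
    have "GDERIV (g i) x :> G i x"
      using C2[OF i] U unfolding C2_with_gradient_on_def by blast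
    from GDERIV_along_curve[OF this \<gamma>(3,1)]
    have d: "((\<lambda>t. g i (\<gamma> t)) has_real_derivative G i x \<bullet> \<xi>) (at 0)" .
    have "\<forall>\<^sub>F t in nhds 0. g i (\<gamma> t) = 0"
      using inMU by eventually_elim (use MU i in blast)
    from DERIV_cong_ev[OF refl this refl, of "G i x \<bullet> \<xi>"] d
    have "((\<lambda>t. 0) has_real_derivative G i x \<bullet> \<xi>) (at 0)" by simp
    then show ?thesis
      using DERIV_unique DERIV_const by blast
  qed
  then show "\<xi> \<in> {\<xi>. \<forall>i<m. G i x \<bullet> \<xi> = 0}" by blast
next
  fix \<xi> assume \<xi>: "\<xi> \<in> {\<xi>. \<forall>i<m. G i x \<bullet> \<xi> = 0}"
  obtain c where c: "\<And>i j. i < m \<Longrightarrow> j < m \<Longrightarrow> G j x \<bullet> c i = (if i = j then 1 else 0)"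
    using dual_family_exists[OF ind] by blast
  define \<Phi> where "\<Phi> = (\<lambda>y. (y - x) - (\<Sum>i<m. (G i x \<bullet> (y - x) - g i y) *\<^sub>R c i))"
  define \<Phi>' where "\<Phi>' = (\<lambda>y. id_blinfun -
      (\<Sum>i<m. blinfun_scaleR_left (c i) o\<^sub>L blinfun_inner_right (G i x - G i y)))"
  have gx: "g i x = 0" if "i < m" for i
    using MU U that by blast
  have \<Phi>x: "\<Phi> x = 0"
    by (simp add: \<Phi>_def gx)
  have der: "(\<Phi> has_derivative blinfun_apply (\<Phi>' y)) (at y)" if y: "y \<in> U" for y
  proof -
    have gd: "(g i has_derivative (\<lambda>\<eta>. \<eta> \<bullet> G i y)) (at y)" if "i < m" for i
      using C2[OF that] y unfolding C2_with_gradient_on_def gderiv_def by blast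
    have "(\<Phi> has_derivative
        (\<lambda>\<eta>. \<eta> - (\<Sum>i<m. (G i x \<bullet> \<eta> - \<eta> \<bullet> G i y) *\<^sub>R c i))) (at y)"
      unfolding \<Phi>_def
      by (auto intro!: derivative_eq_intros gd)
    moreover have "blinfun_apply (\<Phi>' y) =
        (\<lambda>\<eta>. \<eta> - (\<Sum>i<m. (G i x \<bullet> \<eta> - \<eta> \<bullet> G i y) *\<^sub>R c i))"
      by (rule ext) (simp add: \<Phi>'_def blinfun.diff_left blinfun.sum_left inner_diff_left,
          simp add: inner_commute)
    ultimately show ?thesis by simp
  qed
  have contG: "continuous_on U (G i)" if "i < m" for i
    using C2[OF that] by (rule gradient_field_continuous)
  have cont: "continuous_on U \<Phi>'"
    unfolding \<Phi>'_def
    by (intro continuous_intros bounded_bilinear.continuous_on[OF bounded_bilinear_blinfun_compose]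
        bounded_linear.continuous_on[OF bounded_linear_blinfun_inner_right] contG) auto
  have \<Phi>'x: "\<Phi>' x = id_blinfun"
    by (rule blinfun_eqI) (simp add: \<Phi>'_def blinfun.diff_left blinfun.sum_left)
  have inv: "id_blinfun o\<^sub>L \<Phi>' x = id_blinfun"
    by (rule blinfun_eqI) (simp add: \<Phi>'x)
  obtain U' V \<psi> \<psi>' where W: "open U'" "U' \<subseteq> U" "x \<in> U'" "open V" "\<Phi> x \<in> V"
    "homeomorphism U' V \<Phi> \<psi>" "\<And>y. y \<in> V \<Longrightarrow> (\<psi> has_derivative \<psi>' y) (at y)"
    "\<And>y. y \<in> V \<Longrightarrow> \<psi>' y = inv (blinfun_apply (\<Phi>' (\<psi> y)))"
    using inverse_function_theorem[OF U(1) der cont U(3) inv] by metis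
  have \<psi>0: "\<psi> 0 = x"
    using W(6,3) \<Phi>x by (metis homeomorphism_apply1)
  have "0 \<in> V" using W(5) \<Phi>x by simp
  have "inv (blinfun_apply (id_blinfun :: 'a \<Rightarrow>\<^sub>L 'a)) = (\<lambda>\<eta>. \<eta>)"
    by (rule inv_equality) auto
  then have \<psi>d: "(\<psi> has_derivative (\<lambda>\<eta>. \<eta>)) (at 0)"
    using W(7,8)[OF \<open>0 \<in> V\<close>] \<psi>0 \<Phi>'x by simp
  define \<gamma> where "\<gamma> = (\<lambda>t. \<psi> (t *\<^sub>R \<xi>))"
  have "((\<lambda>t::real. t *\<^sub>R \<xi>) has_derivative (\<lambda>t. t *\<^sub>R \<xi>)) (at 0)"
    by (auto intro!: derivative_eq_intros)
  with \<psi>d have "(\<gamma> has_derivative (\<lambda>t. t *\<^sub>R \<xi>)) (at 0)"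
    unfolding \<gamma>_def using has_derivative_compose[of "\<lambda>t. t *\<^sub>R \<xi>" _ 0 UNIV \<psi> "\<lambda>\<eta>. \<eta>"] by simp
  then have \<gamma>d: "(\<gamma> has_vector_derivative \<xi>) (at 0)"
    by (simp add: has_vector_derivative_def)
  have inM: "\<psi> z \<in> M" if z: "z \<in> V" "\<And>j. j < m \<Longrightarrow> G j x \<bullet> z = 0" for z
  proof -
    have "\<psi> z \<in> U" and \<Phi>\<psi>: "\<Phi> (\<psi> z) = z"
      using W(2,6) z(1) by (auto simp: homeomorphism_def)
    have "g j (\<psi> z) = 0" if j: "j < m" for j
    proof -
      have "G j x \<bullet> \<Phi> (\<psi> z) = G j x \<bullet> (\<psi> z - x) -
          (\<Sum>i<m. (G i x \<bullet> (\<psi> z - x) - g i (\<psi> z)) * (G j x \<bullet> c i))"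
        by (simp add: \<Phi>_def inner_diff_right inner_sum_right)
      also have "(\<Sum>i<m. (G i x \<bullet> (\<psi> z - x) - g i (\<psi> z)) * (G j x \<bullet> c i)) =
          (\<Sum>i<m. if i = j then G i x \<bullet> (\<psi> z - x) - g i (\<psi> z) else 0)"
        using c j by (intro sum.cong) auto
      also have "\<dots> = G j x \<bullet> (\<psi> z - x) - g j (\<psi> z)"
        using j by simp
      finally show ?thesis using z(2)[OF j] \<Phi>\<psi> by simp
    qed
    with \<open>\<psi> z \<in> U\<close> MU show ?thesis by blast
  qed
  have "((\<lambda>t::real. t *\<^sub>R \<xi>) \<longlongrightarrow> 0) (nhds 0)"
    by (auto intro!: tendsto_eq_intros filterlim_ident)
  then have "\<forall>\<^sub>F t in nhds 0. t *\<^sub>R \<xi> \<in> V"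
    using W(4) \<open>0 \<in> V\<close> topological_tendstoD by blast
  then have "\<forall>\<^sub>F t in nhds 0. \<gamma> t \<in> M"
    unfolding \<gamma>_def by eventually_elim (use inM \<xi> in auto)
  with \<gamma>d \<psi>0 show "\<xi> \<in> tangent_space M x"
    unfolding tangent_space_def \<gamma>_def
    by (intro CollectI exI[of _ "\<lambda>t. \<psi> (t *\<^sub>R \<xi>)"]) simp
qed

lemma C2_manifold_locally:
  fixes M :: "'a::euclidean_space set"
  assumes "C2_manifold_about M xb"
  obtains U where "open U" "xb \<in> U"
    "\<And>x. x \<in> M \<inter> U \<Longrightarrow> subspace (tangent_space M x)"
    "\<And>x. x \<in> M \<inter> U \<Longrightarrow> \<exists>r>0. closed (M \<inter> cball x r)"
proof -
  obtain U and m :: nat and g G where U: "open U" "xb \<in> U"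
    and C2: "\<And>i. i < m \<Longrightarrow> C2_with_gradient_on (g i) (G i) U"
    and MU: "M \<inter> U = {x \<in> U. \<forall>i<m. g i x = 0}"
    and ind: "\<And>x. x \<in> U \<Longrightarrow> inj_on (\<lambda>i. G i x) {..<m}"
      "\<And>x. x \<in> U \<Longrightarrow> independent ((\<lambda>i. G i x) ` {..<m})"
    using assms unfolding C2_manifold_about_def by blast
  have "subspace (tangent_space M x)" if "x \<in> M \<inter> U" for x
  proof -
    have "tangent_space M x = {\<xi>. \<forall>i<m. G i x \<bullet> \<xi> = 0}"
      using that U C2 MU ind by (intro tangent_space_eq_kernel) auto
    then show ?thesis by (simp add: subspace_def inner_add_right)
  qed
  moreover have "\<exists>r>0. closed (M \<inter> cball x r)" if x: "x \<in> M \<inter> U" for x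
  proof -
    obtain r where r: "r > 0" "cball x r \<subseteq> U"
      using U x by (meson IntD2 open_contains_cball)
    have "closed {z \<in> cball x r. g i z = 0}" if "i < m" for i
      using r C2_function_continuous[OF C2[OF that]]
      by (intro continuous_closed_preimage_constant continuous_at_imp_continuous_on) auto
    then have "closed (cball x r \<inter> (\<Inter>i\<in>{..<m}. {z \<in> cball x r. g i z = 0}))"
      by (intro closed_Int closed_INT ballI) auto
    moreover have "M \<inter> cball x r = cball x r \<inter> (\<Inter>i\<in>{..<m}. {z \<in> cball x r. g i z = 0})"
      using r(2) MU by auto
    ultimately show ?thesis using r(1) by auto
  qed
  ultimately show thesis using that U by blast
qed

section \<open>The covariant derivative\<close>

text \<open>
  Points of \<open>M\<close> outside the ball are at least as far from \<open>y\<close> as \<open>x\<close> is, so the minimum over the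
  closed part inside the ball is a minimum over all of \<open>M\<close>.
\<close>

lemma closest_point_locally_closed:
  fixes M :: "'a::euclidean_space set"
  assumes "closed (M \<inter> cball x r)" "x \<in> M" "dist x y \<le> r / 2"
  shows "closest_point M y \<in> M \<and> (\<forall>z\<in>M. dist y (closest_point M y) \<le> dist y z)"
proof -
  have "0 \<le> r / 2" using assms(3) zero_le_dist[of x y] by linarith
  then have xin: "x \<in> M \<inter> cball x r" using assms(2) by simp
  obtain p where p: "p \<in> M \<inter> cball x r" "\<And>z. z \<in> M \<inter> cball x r \<Longrightarrow> dist y p \<le> dist y z"
    using distance_attains_inf[OF assms(1), of y] xin by blast
  have "dist y p \<le> dist y z" if "z \<in> M" for z
  proof (cases "z \<in> cball x r")
    case True
    then show ?thesis using p that by blast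
  next
    case False
    then have "dist x z > r" by simp
    then have "r / 2 \<le> dist y z"
      using dist_triangle[of x z y] assms(3) by simp
    then show ?thesis
      using p(2)[OF xin] assms(3) by (simp add: dist_commute)
  qed
  with p(1) have "p \<in> M \<and> (\<forall>z\<in>M. dist y p \<le> dist y z)" by simp
  then show ?thesis
    unfolding closest_point_def
    by (rule someI[of "\<lambda>q. q \<in> M \<and> (\<forall>z\<in>M. dist y q \<le> dist y z)"])
qed

text \<open>
  A tangent vector is the velocity of a curve in \<open>M\<close>, which is within \<open>o(t)\<close> of \<open>x + t *\<^sub>R \<xi>\<close>. A
  nearest point of \<open>M\<close> is at least as close, so it follows the line with the same velocity.
\<close>

lemma closest_point_has_vector_derivative:
  fixes M :: "'a::euclidean_space set"
  assumes "closed (M \<inter> cball x r)" "r > 0" "x \<in> M" "\<xi> \<in> tangent_space M x"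
  shows "((\<lambda>t. closest_point M (x + t *\<^sub>R \<xi>)) has_vector_derivative \<xi>) (at 0)"
    and "\<forall>\<^sub>F t in nhds 0. closest_point M (x + t *\<^sub>R \<xi>) \<in> M"
proof -
  let ?p = "\<lambda>t. closest_point M (x + t *\<^sub>R \<xi>)"
  obtain \<gamma> where \<gamma>: "\<gamma> 0 = x" "\<forall>\<^sub>F t in nhds 0. \<gamma> t \<in> M"
    "(\<gamma> has_vector_derivative \<xi>) (at 0)"
    using assms(4) unfolding tangent_space_def by blast
  have "((\<lambda>t. x + t *\<^sub>R \<xi>) \<longlongrightarrow> x) (nhds 0)"
    by (auto intro!: tendsto_eq_intros filterlim_ident)
  then have "\<forall>\<^sub>F t in nhds 0. dist (x + t *\<^sub>R \<xi>) x < r / 2"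
    using assms(2) by (intro tendstoD) auto
  then have near: "\<forall>\<^sub>F t in nhds 0. ?p t \<in> M \<and> (\<forall>z\<in>M. dist (x + t *\<^sub>R \<xi>) (?p t) \<le> dist (x + t *\<^sub>R \<xi>) z)"
    by eventually_elim (rule closest_point_locally_closed[OF assms(1,3)], simp add: dist_commute)
  then show "\<forall>\<^sub>F t in nhds 0. ?p t \<in> M"
    by eventually_elim blast
  have p0: "?p 0 = x"
    using assms(3) by (simp add: closest_point_self)
  have lim: "((\<lambda>t. norm (\<gamma> t - x - t *\<^sub>R \<xi>) / norm t) \<longlongrightarrow> 0) (at 0)"
    using \<gamma>(1,3) unfolding has_vector_derivative_def has_derivative_iff_norm by simp
  have "\<forall>\<^sub>F t in nhds 0. norm (?p t - x - t *\<^sub>R \<xi>) \<le> norm (\<gamma> t - x - t *\<^sub>R \<xi>)"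
    using near \<gamma>(2)
  proof eventually_elim
    case (elim t)
    then have "dist (x + t *\<^sub>R \<xi>) (?p t) \<le> dist (x + t *\<^sub>R \<xi>) (\<gamma> t)" by blast
    then show ?case by (simp add: dist_norm norm_minus_commute algebra_simps)
  qed
  then have "\<forall>\<^sub>F t in at 0. norm (?p t - x - t *\<^sub>R \<xi>) / norm t \<le> norm (\<gamma> t - x - t *\<^sub>R \<xi>) / norm t"
    by (auto simp: eventually_nhds_conv_at divide_right_mono elim: eventually_mono)
  then have "((\<lambda>t. norm (?p t - x - t *\<^sub>R \<xi>) / norm t) \<longlongrightarrow> 0) (at 0)"
    by (intro tendsto_sandwich[OF _ _ tendsto_const lim]) auto
  then show "(?p has_vector_derivative \<xi>) (at 0)"
    unfolding has_vector_derivative_def has_derivative_iff_norm using p0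
    by (simp add: bounded_linear_scaleR_left)
qed

text \<open>
  The covariant derivative is the orthogonal projection onto the tangent space of the gradient of any
  smooth extension \<open>h\<close> of \<open>f\<close> from \<open>M\<close>.
\<close>

lemma covariant_derivative_tangential_gradient:
  fixes M :: "'a::euclidean_space set"
  assumes M: "closed (M \<inter> cball x r)" "r > 0" "x \<in> M"
    and T: "subspace (tangent_space M x)"
    and U: "open U" "x \<in> U" "\<And>y. y \<in> M \<inter> U \<Longrightarrow> f y = ereal (h y)"
    and D: "GDERIV h x :> D"
  shows "covariant_derivative M f x \<in> tangent_space M x"
    and "\<xi> \<in> tangent_space M x \<Longrightarrow> covariant_derivative M f x \<bullet> \<xi> = D \<bullet> \<xi>"
proof -
  let ?T = "tangent_space M x"
  let ?F = "\<lambda>\<xi> t. real_of_ereal (f (closest_point M (x + t *\<^sub>R \<xi>)))"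
  have der: "(?F \<xi> has_real_derivative D \<bullet> \<xi>) (at 0)" if "\<xi> \<in> ?T" for \<xi>
  proof -
    let ?p = "\<lambda>t. closest_point M (x + t *\<^sub>R \<xi>)"
    note p = closest_point_has_vector_derivative[OF M that]
    have p0: "?p 0 = x"
      using M by (simp add: closest_point_self)
    have "(?p \<longlongrightarrow> x) (at 0)"
      using has_vector_derivative_continuous[OF p(1)] p0 by (simp add: continuous_within)
    then have "\<forall>\<^sub>F t in at 0. ?p t \<in> U"
      using U topological_tendstoD by blast
    then have "\<forall>\<^sub>F t in nhds 0. ?p t \<in> U"
      using p0 U by (simp add: eventually_nhds_conv_at)
    with p(2) have "\<forall>\<^sub>F t in nhds 0. ?F \<xi> t = h (?p t)"
      by eventually_elim (use U(3) in auto)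
    from DERIV_cong_ev[OF refl this refl] GDERIV_along_curve[OF D p(1) p0]
    show ?thesis by blast
  qed
  obtain g z where g: "g \<in> span ?T" "\<And>w. w \<in> span ?T \<Longrightarrow> orthogonal z w" "D = g + z"
    using orthogonal_subspace_decomp_exists[of ?T D] by metis
  have gT: "g \<in> ?T" "\<And>\<xi>. \<xi> \<in> ?T \<Longrightarrow> g \<bullet> \<xi> = D \<bullet> \<xi>"
    using g T by (auto simp: span_eq_iff[THEN iffD2] inner_add_left orthogonal_def)
  have "covariant_derivative M f x = g"
    unfolding covariant_derivative_def
  proof (rule the_equality)
    show "g \<in> ?T \<and> (\<forall>\<xi>\<in>?T. (?F \<xi> has_real_derivative g \<bullet> \<xi>) (at 0))"
      using gT der by simp
  next
    fix g' assume g': "g' \<in> ?T \<and> (\<forall>\<xi>\<in>?T. (?F \<xi> has_real_derivative g' \<bullet> \<xi>) (at 0))"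
    have "g' \<bullet> \<xi> = g \<bullet> \<xi>" if "\<xi> \<in> ?T" for \<xi>
      using g' der[OF that] that gT(2) DERIV_unique by metis
    then have "(g' - g) \<bullet> (g' - g) = 0"
      using g' gT(1) by (simp add: inner_diff_left inner_diff_right)
    then show "g' = g" by simp
  qed
  with gT show "covariant_derivative M f x \<in> ?T"
    and "\<xi> \<in> ?T \<Longrightarrow> covariant_derivative M f x \<bullet> \<xi> = D \<bullet> \<xi>" by simp_all
qed

text \<open>
  Along a curve in \<open>M\<close> through \<open>x\<close>, the difference of \<open>h\<close> and the quadratic lower model has a local
  minimum at \<open>x\<close>. Its derivative therefore vanishes there, so \<open>v\<close> agrees with the gradient on tangent
  vectors, in particular on the covariant derivative itself.
\<close>

lemma norm_covariant_derivative_le: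
  fixes M :: "'a::euclidean_space set"
  assumes M: "closed (M \<inter> cball x r)" "r > 0" "x \<in> M"
    and T: "subspace (tangent_space M x)"
    and U: "open U" "x \<in> U" "\<And>y. y \<in> M \<inter> U \<Longrightarrow> f y = ereal (h y)"
    and D: "GDERIV h x :> D"
    and d: "d > 0" "\<And>y. norm (y - x) < d \<Longrightarrow>
        f y \<ge> f x + ereal (v \<bullet> (y - x) - \<rho> / 2 * (norm (y - x))\<^sup>2)"
  shows "norm (covariant_derivative M f x) \<le> norm v"
proof -
  let ?g = "covariant_derivative M f x"
  note cov = covariant_derivative_tangential_gradient[OF M T U D]
  have "v \<bullet> \<xi> = D \<bullet> \<xi>" if \<xi>: "\<xi> \<in> tangent_space M x" for \<xi>
  proof -
    obtain \<gamma> where \<gamma>: "\<gamma> 0 = x" "\<forall>\<^sub>F t in nhds 0. \<gamma> t \<in> M"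
      "(\<gamma> has_vector_derivative \<xi>) (at 0)"
      using \<xi> unfolding tangent_space_def by blast
    define k where "k = (\<lambda>y. h y - v \<bullet> (y - x) + \<rho> / 2 * ((y - x) \<bullet> (y - x)))"
    have "GDERIV k x :> D - v"
      unfolding k_def gderiv_def using D[unfolded gderiv_def]
      by (auto intro!: derivative_eq_intros simp: inner_diff_right inner_commute)
    from GDERIV_along_curve[OF this \<gamma>(3,1)]
    have kd: "((\<lambda>t. k (\<gamma> t)) has_real_derivative (D - v) \<bullet> \<xi>) (at 0)" .
    have "(\<gamma> \<longlongrightarrow> x) (at 0)"
      using has_vector_derivative_continuous[OF \<gamma>(3)] \<gamma>(1) by (simp add: continuous_within)
    then have "\<forall>\<^sub>F t in at 0. \<gamma> t \<in> U \<inter> ball x d"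
      using U d by (intro topological_tendstoD) auto
    then have "\<forall>\<^sub>F t in nhds 0. \<gamma> t \<in> U \<inter> ball x d"
      using \<gamma>(1) U d(1) by (simp add: eventually_nhds_conv_at)
    with \<gamma>(2) have "\<forall>\<^sub>F t in nhds 0. k (\<gamma> 0) \<le> k (\<gamma> t)"
    proof eventually_elim
      case (elim t)
      then have "norm (\<gamma> t - x) < d" by (simp add: dist_norm norm_minus_commute)
      from d(2)[OF this] U(2,3) elim M(3)
      have "h x + (v \<bullet> (\<gamma> t - x) - \<rho> / 2 * (norm (\<gamma> t - x))\<^sup>2) \<le> h (\<gamma> t)" by simp
      then show ?case by (simp add: k_def \<gamma>(1) power2_norm_eq_inner)
    qed
    then obtain e where e: "e > 0" "\<And>t. dist t 0 < e \<Longrightarrow> k (\<gamma> 0) \<le> k (\<gamma> t)"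
      unfolding eventually_nhds_metric by blast
    have "\<forall>t. \<bar>0 - t\<bar> < e \<longrightarrow> k (\<gamma> 0) \<le> k (\<gamma> t)"
      using e(2) by simp
    from DERIV_local_min[OF kd e(1) this] show ?thesis
      by (simp add: inner_diff_left)
  qed
  then have "norm ?g * norm ?g = v \<bullet> ?g"
    using cov by (simp flip: power2_eq_square add: power2_norm_eq_inner)
  also have "\<dots> \<le> norm v * norm ?g" by (rule norm_cauchy_schwarz)
  finally show ?thesis
    by (cases "norm ?g = 0") auto
qed

section \<open>Identification of the manifold\<close>

text \<open>
  Comparing distances to \<open>z\<close> and to the nearest point \<open>p\<close> bounds the inner product of \<open>x - p\<close> and
  \<open>z - p\<close> by \<open>(norm (z - p))\<^sup>2 / 2\<close>, which is of higher order.
\<close>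

lemma proximal_normal_regular:
  fixes M :: "'a::euclidean_space set"
  assumes "p \<in> M" "\<And>z. z \<in> M \<Longrightarrow> dist x p \<le> dist x z" "\<kappa> \<ge> 0"
  shows "\<kappa> *\<^sub>R (x - p) \<in> regular_normal_cone M p"
proof -
  let ?v = "\<kappa> *\<^sub>R (x - p)"
  let ?q = "\<lambda>z. (delta_fun M z - delta_fun M p - ereal (?v \<bullet> (z - p))) / ereal (norm (z - p))"
  have bound: "?v \<bullet> (z - p) \<le> \<kappa> / 2 * (norm (z - p))\<^sup>2" if "z \<in> M" for z
  proof -
    have "(norm (x - p))\<^sup>2 \<le> (norm (x - z))\<^sup>2"
      using assms(2)[OF that] by (simp add: dist_norm)
    moreover have "x - z = (x - p) - (z - p)" by simp
    ultimately have "2 * ((x - p) \<bullet> (z - p)) \<le> (norm (z - p))\<^sup>2"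
      by (simp only: power2_norm_eq_inner inner_diff_left inner_diff_right inner_commute)
         (simp add: inner_commute algebra_simps)
    then have "\<kappa> * (2 * ((x - p) \<bullet> (z - p))) \<le> \<kappa> * (norm (z - p))\<^sup>2"
      using assms(3) by (rule mult_left_mono)
    then show ?thesis by simp
  qed
  have le: "ereal (- \<kappa> / 2 * norm (z - p)) \<le> ?q z" if "z \<noteq> p" for z
  proof (cases "z \<in> M")
    case True
    have "- (\<kappa> / 2 * (norm (z - p))\<^sup>2) / norm (z - p) \<le> - (?v \<bullet> (z - p)) / norm (z - p)"
      using bound[OF True] by (intro divide_right_mono) auto
    then have "- \<kappa> / 2 * norm (z - p) \<le> - (?v \<bullet> (z - p)) / norm (z - p)"
      using that by (simp add: power2_eq_square)
    then show ?thesis using True assms(1) that by (simp add: delta_fun_def)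
  next
    case False
    then show ?thesis using assms(1) that by (simp add: delta_fun_def)
  qed
  have "((\<lambda>z. ereal (- \<kappa> / 2 * norm (z - p))) \<longlongrightarrow> ereal (- \<kappa> / 2 * norm (p - p))) (at p)"
    by (intro tendsto_intros)
  then have "((\<lambda>z. ereal (- \<kappa> / 2 * norm (z - p))) \<longlongrightarrow> 0) (at p)" by (simp add: zero_ereal_def)
  then have "0 = Liminf (at p) (\<lambda>z. ereal (- \<kappa> / 2 * norm (z - p)))"
    by (simp add: lim_imp_Liminf)
  also have "\<dots> \<le> Liminf (at p) ?q"
    by (rule Liminf_mono) (use le in \<open>auto simp: eventually_at_filter\<close>)
  finally show ?thesis
    using assms(1) unfolding regular_normal_cone_def regular_subdiff_def
    by (simp add: edom_def delta_fun_def)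
qed

lemma normal_coneI_limit:
  fixes M :: "'a::euclidean_space set"
  assumes "xb \<in> M" "P \<longlonglongrightarrow> xb" "W \<longlonglongrightarrow> w" "\<And>n. P n \<in> M" "\<And>n. W n \<in> regular_normal_cone M (P n)"
  shows "w \<in> normal_cone M xb"
proof -
  have "(\<lambda>t. delta_fun M (P t)) \<longlonglongrightarrow> delta_fun M xb" "xb \<in> edom (delta_fun M)"
    using assms(1,4) by (auto simp: delta_fun_def edom_def)
  with assms show ?thesis
    unfolding normal_cone_def subdiff_def regular_normal_cone_def by blast
qed

text \<open>
  For \<open>S\<close> the set of subgradients and \<open>N\<close> the normal cone at a point. The affine hull of \<open>S\<close> contains
  \<open>0\<close>, so it is a linear subspace. As a translate of \<open>N\<close>, which contains \<open>0\<close> too, it contains the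
  translation vector, and hence equals \<open>N\<close> itself. Short multiples of \<open>w\<close> therefore lie in \<open>S\<close>.
\<close>

lemma small_normals_in_set:
  fixes S :: "'a::euclidean_space set"
  assumes "0 \<in> rel_interior S" "affine hull S = (\<lambda>w. a + w) ` N" "0 \<in> N" "w \<in> N" "norm w = 1"
  obtains e where "e > 0" "e *\<^sub>R w \<in> S"
proof -
  let ?A = "affine hull S"
  obtain e where e: "e > 0" "ball 0 e \<inter> ?A \<subseteq> S" and "0 \<in> S"
    using assms(1) by (auto simp: mem_rel_interior_ball)
  then have "subspace ?A"
    by (simp add: subspace_affine hull_inc)
  moreover have "a \<in> ?A" "a + w \<in> ?A"
    using assms(2-4) by (auto simp: image_iff intro: bexI[of _ 0])
  ultimately have "w \<in> ?A"
    using subspace_diff by fastforce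
  then have "(e / 2) *\<^sub>R w \<in> ?A"
    using \<open>subspace ?A\<close> subspace_scale by blast
  then have "(e / 2) *\<^sub>R w \<in> S"
    using e assms(5) by auto
  with e(1) show thesis by (intro that[of "e / 2"]) auto
qed

lemma prox_regular_at_forE:
  assumes "prox_regular_at f xb" "vb \<in> subdiff f xb"
  obtains \<delta> \<rho> where "\<delta> > 0" "\<And>x x' v. norm (x - xb) < \<delta> \<Longrightarrow> norm (x' - xb) < \<delta> \<Longrightarrow>
      \<bar>f x - f xb\<bar> < ereal \<delta> \<Longrightarrow> v \<in> subdiff f x \<Longrightarrow> norm (v - vb) < \<delta> \<Longrightarrow>
      f x' \<ge> f x + ereal (v \<bullet> (x' - x) - \<rho> / 2 * (norm (x' - x))\<^sup>2)"
proof -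
  have "prox_regular_at_for f xb vb"
    using assms unfolding prox_regular_at_def by blast
  then obtain \<rho> \<delta> where "\<delta> > 0" "\<forall>x x' v. norm (x - xb) < \<delta> \<and> norm (x' - xb) < \<delta> \<and>
      \<bar>f x - f xb\<bar> < ereal \<delta> \<and> v \<in> subdiff f x \<and> norm (v - vb) < \<delta> \<longrightarrow>
      f x' \<ge> f x + ereal (v \<bullet> (x' - x) - \<rho> / 2 * (norm (x' - x))\<^sup>2)"
    unfolding prox_regular_at_for_def by auto
  then show thesis
    by (intro that[of \<delta> \<rho>]) simp_all
qed

text \<open>
  For \<open>X n\<close> off \<open>M\<close> with nearest points \<open>P n\<close>, adding the prox-regularity inequality from \<open>X n\<close> to
  \<open>P n\<close> (small subgradient \<open>V n\<close>) and the one from \<open>P n\<close> to \<open>X n\<close> (subgradient near a positive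
  multiple \<open>e *\<^sub>R w\<close> of the limiting normal) cancels the function values. Divided by
  \<open>norm (X n - P n)\<close>, the sum gives \<open>e \<le> 0\<close> in the limit, which is absurd.
\<close>

lemma small_subgradients_only_on_manifold:
  fixes f :: "'a::euclidean_space \<Rightarrow> ereal"
  assumes prox: "prox_regular_at f xb" and ps: "C2_partly_smooth f xb M"
    and ri: "0 \<in> rel_interior (subdiff f xb)"
  obtains \<delta> where "\<delta> > 0" "\<And>x v. norm (x - xb) < \<delta> \<Longrightarrow> \<bar>f x - f xb\<bar> < ereal \<delta> \<Longrightarrow>
      v \<in> subdiff f x \<Longrightarrow> norm v < \<delta> \<Longrightarrow> x \<in> M"
proof (rule ccontr)
  assume contra: "\<not> thesis"
  have man: "C2_manifold_about M xb" and xbM: "xb \<in> M"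
    using ps unfolding C2_partly_smooth_def C2_manifold_about_def by blast+
  obtain U0 where U0: "xb \<in> U0" "\<And>x. x \<in> M \<inter> U0 \<Longrightarrow> \<exists>r>0. closed (M \<inter> cball x r)"
    using C2_manifold_locally[OF man] by metis
  then obtain r where r: "r > 0" "closed (M \<inter> cball xb r)"
    using xbM by blast
  obtain U h G where U: "open U" "xb \<in> U" "C2_with_gradient_on h G U"
    "\<And>x. x \<in> M \<inter> U \<Longrightarrow> f x = ereal (h x)"
    using ps unfolding C2_partly_smooth_def C2_along_at_def by blast
  have fxb: "f xb = ereal (h xb)"
    using U xbM by blast

  \<comment> \<open>The factor \<open>r / 2\<close> keeps all terms of the sequence in the region where \<open>M\<close> has nearest points.\<close>
  have "\<exists>x v. norm (x - xb) < r / 2 / Suc n \<and> \<bar>f x - f xb\<bar> < ereal (r / 2 / Suc n) \<and>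
      v \<in> subdiff f x \<and> norm v < r / 2 / Suc n \<and> x \<notin> M" for n
    using contra that[of "r / 2 / Suc n"] r(1)
    by (metis divide_pos_pos of_nat_0_less_iff zero_less_Suc zero_less_numeral)
  then obtain X V where XV: "\<And>n. norm (X n - xb) < r / 2 / Suc n"
    "\<And>n. \<bar>f (X n) - f xb\<bar> < ereal (r / 2 / Suc n)"
    "\<And>n. V n \<in> subdiff f (X n)" "\<And>n. norm (V n) < r / 2 / Suc n" "\<And>n. X n \<notin> M"
    by metis
  have null: "(\<lambda>n. r / 2 / real (Suc n)) \<longlonglongrightarrow> 0"
    using lim_const_over_n[of "r / 2"] by (rule LIMSEQ_Suc)
  have X: "X \<longlonglongrightarrow> xb"
  proof -
    have "(\<lambda>n. norm (X n - xb)) \<longlonglongrightarrow> 0"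
      by (rule tendsto_sandwich[OF _ _ tendsto_const null]) (use XV(1) in \<open>auto intro!: always_eventually less_imp_le\<close>)
    then show ?thesis using Lim_null tendsto_norm_zero_iff by blast
  qed
  have V: "V \<longlonglongrightarrow> 0"
    by (rule Lim_null_comparison[OF _ null]) (use XV(4) in \<open>auto intro!: always_eventually less_imp_le\<close>)

  define P where "P = (\<lambda>n. closest_point M (X n))"
  have P: "P n \<in> M" "\<And>z. z \<in> M \<Longrightarrow> dist (X n) (P n) \<le> dist (X n) z" for n
  proof -
    have "r / 2 / real (Suc n) \<le> r / 2 / 1"
      using r(1) by (intro divide_left_mono) auto
    with XV(1)[of n] have "norm (X n - xb) \<le> r / 2" by linarith
    then have "dist xb (X n) \<le> r / 2"
      by (simp add: dist_norm norm_minus_commute)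
    then show "P n \<in> M" "\<And>z. z \<in> M \<Longrightarrow> dist (X n) (P n) \<le> dist (X n) z"
      using closest_point_locally_closed[OF r(2) xbM] unfolding P_def by blast+
  qed
  have XP: "(\<lambda>n. X n - P n) \<longlonglongrightarrow> 0"
  proof (rule Lim_null_comparison)
    show "\<forall>\<^sub>F n in sequentially. norm (X n - P n) \<le> norm (X n - xb)"
      using P(2)[OF xbM] by (auto simp: dist_norm)
    show "(\<lambda>n. norm (X n - xb)) \<longlonglongrightarrow> 0"
      using X Lim_null tendsto_norm_zero by blast
  qed
  have Plim: "P \<longlonglongrightarrow> xb"
    using tendsto_diff[OF X XP] by simp
  have pos: "norm (X n - P n) > 0" for n
    using P(1)[of n] XV(5)[of n] by auto
  define W where "W = (\<lambda>n. (1 / norm (X n - P n)) *\<^sub>R (X n - P n))"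
  have W1: "norm (W n) = 1" for n
    using pos[of n] by (simp add: W_def)
  have Wreg: "W n \<in> regular_normal_cone M (P n)" for n
    unfolding W_def using P by (intro proximal_normal_regular) auto
  have "\<And>n. W n \<in> sphere 0 1" using W1 by simp
  then obtain w s where w: "w \<in> sphere 0 1" and s: "strict_mono s" and Ws: "(W \<circ> s) \<longlonglongrightarrow> w"
    using compact_sphere[of "0::'a" 1] unfolding compact_def by metis
  have Xs: "(\<lambda>n. X (s n)) \<longlonglongrightarrow> xb" and Ps: "(\<lambda>n. P (s n)) \<longlonglongrightarrow> xb"
    and Vs: "(\<lambda>n. V (s n)) \<longlonglongrightarrow> 0" and XPs: "(\<lambda>n. X (s n) - P (s n)) \<longlonglongrightarrow> 0"
    using LIMSEQ_subseq_LIMSEQ[OF _ s] X Plim V XP by (auto simp: o_def)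

  have "w \<in> normal_cone M xb"
    using Ws Ps xbM P(1) Wreg by (intro normal_coneI_limit[of xb M "\<lambda>n. P (s n)" "W \<circ> s"]) auto
  moreover have "0 \<in> normal_cone M xb"
    using proximal_normal_regular[OF xbM, of xb 0] xbM
    by (intro normal_coneI_limit[of xb M "\<lambda>_. xb" "\<lambda>_. 0"]) auto
  moreover obtain a where "affine hull (subdiff f xb) = (\<lambda>w. a + w) ` normal_cone M xb"
    using ps unfolding C2_partly_smooth_def by blast
  ultimately obtain e where e: "e > 0" "e *\<^sub>R w \<in> subdiff f xb"
    using small_normals_in_set[OF ri] w by (metis dist_0_norm mem_sphere)
  have zero: "0 \<in> subdiff f xb"
    using ri rel_interior_subset by blast

  have "setvalued_continuous_within (subdiff f) xb M"
    using ps unfolding C2_partly_smooth_def by blast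
  then have "\<forall>v\<in>subdiff f xb. \<forall>xs. (\<forall>t::nat. xs t \<in> M) \<and> xs \<longlonglongrightarrow> xb \<longrightarrow>
      (\<exists>us. (\<forall>\<^sub>F t in sequentially. us t \<in> subdiff f (xs t)) \<and> us \<longlonglongrightarrow> v)"
    unfolding setvalued_continuous_within_def by (rule conjunct2)
  from this[rule_format, OF e(2), of "\<lambda>t. P (s t)"] P(1) Ps
  obtain us where us: "\<forall>\<^sub>F t in sequentially. us t \<in> subdiff f (P (s t))" "us \<longlonglongrightarrow> e *\<^sub>R w"
    by blast

  obtain \<rho>0 \<delta>0 where \<delta>0: "\<delta>0 > 0" and prox0: "\<And>x x' v. norm (x - xb) < \<delta>0 \<Longrightarrow> norm (x' - xb) < \<delta>0 \<Longrightarrow>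
      \<bar>f x - f xb\<bar> < ereal \<delta>0 \<Longrightarrow> v \<in> subdiff f x \<Longrightarrow> norm (v - 0) < \<delta>0 \<Longrightarrow>
      f x' \<ge> f x + ereal (v \<bullet> (x' - x) - \<rho>0 / 2 * (norm (x' - x))\<^sup>2)"
    by (fact prox_regular_at_forE[OF prox zero])
  obtain \<rho>1 \<delta>1 where \<delta>1: "\<delta>1 > 0" and prox1: "\<And>x x' v. norm (x - xb) < \<delta>1 \<Longrightarrow> norm (x' - xb) < \<delta>1 \<Longrightarrow>
      \<bar>f x - f xb\<bar> < ereal \<delta>1 \<Longrightarrow> v \<in> subdiff f x \<Longrightarrow> norm (v - e *\<^sub>R w) < \<delta>1 \<Longrightarrow>
      f x' \<ge> f x + ereal (v \<bullet> (x' - x) - \<rho>1 / 2 * (norm (x' - x))\<^sup>2)"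
    by (fact prox_regular_at_forE[OF prox e(2)])
  define \<delta> where "\<delta> = min \<delta>0 \<delta>1"
  have \<delta>: "\<delta> > 0" "\<delta> \<le> \<delta>0" "\<delta> \<le> \<delta>1" using \<delta>0 \<delta>1 by (auto simp: \<delta>_def)
  define C where "C = (\<rho>0 + \<rho>1) / 2"

  have "isCont h xb"
    using C2_function_continuous U by blast
  then have hP: "(\<lambda>n. h (P (s n))) \<longlonglongrightarrow> h xb"
    using Ps isCont_tendsto_compose by blast
  have "\<forall>\<^sub>F n in sequentially. P (s n) \<in> U"
    using Ps U topological_tendstoD by blast
  moreover have "\<forall>\<^sub>F n in sequentially. dist (X (s n)) xb < \<delta>"
    using Xs \<delta> by (intro tendstoD) auto
  moreover have "\<forall>\<^sub>F n in sequentially. dist (P (s n)) xb < \<delta>"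
    using Ps \<delta> by (intro tendstoD) auto
  moreover have "\<forall>\<^sub>F n in sequentially. dist (V (s n)) 0 < \<delta>"
    using Vs \<delta> by (intro tendstoD) auto
  moreover have "\<forall>\<^sub>F n in sequentially. dist (us n) (e *\<^sub>R w) < \<delta>"
    using us \<delta> by (intro tendstoD) auto
  moreover have "\<forall>\<^sub>F n in sequentially. dist (h (P (s n))) (h xb) < \<delta>"
    using hP \<delta> by (intro tendstoD) auto
  moreover have "\<forall>\<^sub>F n in sequentially. r / 2 / real (Suc (s n)) < \<delta>"
    using LIMSEQ_subseq_LIMSEQ[OF null s] \<delta> by (intro order_tendstoD) (auto simp: o_def)
  ultimately have "\<forall>\<^sub>F n in sequentially. (us n - V (s n)) \<bullet> W (s n) \<le> C * norm (X (s n) - P (s n))"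
    using us(1)
  proof eventually_elim
    case (elim n)
    let ?x = "X (s n)" and ?p = "P (s n)"
    let ?d = "norm (?x - ?p)"
    have fp: "f ?p = ereal (h ?p)"
      using elim P(1) U by blast
    have fx: "\<bar>f ?x - f xb\<bar> < ereal \<delta>"
      using XV(2)[of "s n"] elim by (meson ereal_less(2) less_ereal.simps(1) less_trans)
    then obtain y where y: "f ?x = ereal y"
      using fxb by (cases "f ?x") auto
    have "f ?p \<ge> f ?x + ereal (V (s n) \<bullet> (?p - ?x) - \<rho>0 / 2 * (norm (?p - ?x))\<^sup>2)"
      using elim \<delta> fx XV(3)
      by (intro prox0) (auto simp: dist_norm intro: less_le_trans)
    then have 1: "h ?p \<ge> y + (V (s n) \<bullet> (?p - ?x) - \<rho>0 / 2 * ?d\<^sup>2)"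
      by (simp add: fp y norm_minus_commute)
    have "\<bar>f ?p - f xb\<bar> < ereal \<delta>1"
      using elim \<delta> by (auto simp: fp fxb dist_real_def)
    then have "f ?x \<ge> f ?p + ereal (us n \<bullet> (?x - ?p) - \<rho>1 / 2 * ?d\<^sup>2)"
      using elim \<delta> by (intro prox1) (auto simp: dist_norm)
    then have 2: "y \<ge> h ?p + (us n \<bullet> (?x - ?p) - \<rho>1 / 2 * ?d\<^sup>2)"
      by (simp add: fp y)
    have "V (s n) \<bullet> (?p - ?x) = - (V (s n) \<bullet> (?x - ?p))"
      by (simp add: inner_diff_right)
    with 1 2 have "(us n - V (s n)) \<bullet> (?x - ?p) \<le> C * ?d\<^sup>2"
      by (simp add: C_def inner_diff_left algebra_simps add_divide_distrib)
    then have "(us n - V (s n)) \<bullet> (?x - ?p) / ?d \<le> C * ?d"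
      using pos[of "s n"] by (simp add: pos_divide_le_eq power2_eq_square algebra_simps)
    then show ?case by (simp add: W_def)
  qed
  moreover have "(\<lambda>n. (us n - V (s n)) \<bullet> W (s n)) \<longlonglongrightarrow> (e *\<^sub>R w - 0) \<bullet> w"
    using us(2) Vs Ws by (intro tendsto_intros) (auto simp: o_def)
  moreover have "(\<lambda>n. C * norm (X (s n) - P (s n))) \<longlonglongrightarrow> C * norm (0::'a)"
    using XPs by (intro tendsto_intros)
  ultimately have "(e *\<^sub>R w - 0) \<bullet> w \<le> C * norm (0::'a)"
    by (intro tendsto_le[OF sequentially_bot]) auto
  then have "e * (w \<bullet> w) \<le> 0" by simp
  moreover have "w \<bullet> w = 1"
    using w by (simp flip: power2_norm_eq_inner)
  ultimately show False using e(1) by simp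
qed

section \<open>The KL property\<close>

theorem theorem3p7:
  fixes f :: "real ^ 'n \<Rightarrow> ereal" and xb :: "real ^ 'n" and M :: "(real ^ 'n) set"
    and c \<nu> \<epsilon> \<alpha> :: real
  assumes "proper_fun f" and "closed_fun f"
    and "prox_regular_at f xb"
    and "C2_partly_smooth f xb M"
    and "0 \<in> rel_interior (subdiff f xb)"
    and "c > 0" and "\<nu> > 0" and "\<epsilon> > 0" and "0 \<le> \<alpha>" and "\<alpha> < 1"
    and "\<And>x. x \<in> M \<Longrightarrow> norm (x - xb) \<le> \<epsilon> \<Longrightarrow> f xb < f x \<Longrightarrow> f x < f xb + ereal \<nu> \<Longrightarrow>
           norm (covariant_derivative M f x) \<ge> c * real_of_ereal (f x - f xb) powr \<alpha>"
  shows "KL_property f xb \<alpha>"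
proof -
  note prox = assms(3) and ps = assms(4) and ri = assms(5)
  have zero: "0 \<in> subdiff f xb"
    using ri rel_interior_subset by blast
  have man: "C2_manifold_about M xb" and xbM: "xb \<in> M"
    using ps unfolding C2_partly_smooth_def C2_manifold_about_def by blast+
  obtain U0 where U0: "open U0" "xb \<in> U0" "\<And>x. x \<in> M \<inter> U0 \<Longrightarrow> subspace (tangent_space M x)"
    "\<And>x. x \<in> M \<inter> U0 \<Longrightarrow> \<exists>r>0. closed (M \<inter> cball x r)"
    using C2_manifold_locally[OF man] by metis
  obtain U h G where U: "open U" "xb \<in> U" "C2_with_gradient_on h G U"
    "\<And>x. x \<in> M \<inter> U \<Longrightarrow> f x = ereal (h x)"
    using ps unfolding C2_partly_smooth_def C2_along_at_def by blast
  have fxb: "f xb = ereal (h xb)"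
    using U xbM by blast
  obtain \<delta>1 where \<delta>1: "\<delta>1 > 0" and ident: "\<And>x v. norm (x - xb) < \<delta>1 \<Longrightarrow> \<bar>f x - f xb\<bar> < ereal \<delta>1 \<Longrightarrow>
      v \<in> subdiff f x \<Longrightarrow> norm v < \<delta>1 \<Longrightarrow> x \<in> M"
    using small_subgradients_only_on_manifold[OF prox ps ri] by blast
  obtain \<rho> \<delta>0 where \<delta>0: "\<delta>0 > 0" and prox0: "\<And>x x' v. norm (x - xb) < \<delta>0 \<Longrightarrow> norm (x' - xb) < \<delta>0 \<Longrightarrow>
      \<bar>f x - f xb\<bar> < ereal \<delta>0 \<Longrightarrow> v \<in> subdiff f x \<Longrightarrow> norm (v - 0) < \<delta>0 \<Longrightarrow>
      f x' \<ge> f x + ereal (v \<bullet> (x' - x) - \<rho> / 2 * (norm (x' - x))\<^sup>2)"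
    by (fact prox_regular_at_forE[OF prox zero])
  define \<delta> where "\<delta> = min \<delta>0 \<delta>1"
  have \<delta>: "\<delta> > 0" "\<delta> \<le> \<delta>0" "\<delta> \<le> \<delta>1"
    using \<delta>0 \<delta>1 by (auto simp: \<delta>_def)
  obtain \<epsilon>1 where \<epsilon>1: "\<epsilon>1 > 0" "ball xb \<epsilon>1 \<subseteq> U \<inter> U0"
    using U U0 by (meson IntI open_Int open_contains_ball)
  define \<epsilon>' where "\<epsilon>' = min \<epsilon> (min (\<epsilon>1 / 2) (\<delta> / 2))"
  \<comment> \<open>The bound 1 makes the power of the gap at most 1; \<open>\<delta>\<close> keeps \<open>f x\<close> close to \<open>f xb\<close>.\<close>
  define \<nu>' where "\<nu>' = min \<nu> (min 1 \<delta>)"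
  define c' where "c' = min c \<delta>"
  have main: "c' * real_of_ereal (f x - f xb) powr \<alpha> \<le> norm v"
    if x: "norm (x - xb) \<le> \<epsilon>'" "f xb < f x" "f x < f xb + ereal \<nu>'" and v: "v \<in> subdiff f x" for x v
  proof -
    obtain y where y: "f x = ereal y"
      using x(2,3) fxb by (cases "f x") auto
    have "h xb < y" "y < h xb + \<nu>'"
      using x(2,3) by (simp_all add: y fxb)
    then have gap: "0 < y - h xb" "y - h xb < \<nu>" "y - h xb < 1" "y - h xb < \<delta>"
      by (auto simp: \<nu>'_def)
    have near: "norm (x - xb) \<le> \<epsilon>" "norm (x - xb) < \<epsilon>1" "norm (x - xb) < \<delta>"
      using x(1) \<epsilon>1(1) \<delta>(1) by (auto simp: \<epsilon>'_def)
    let ?t = "(y - h xb) powr \<alpha>"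
    have "c' * ?t \<le> norm v"
    proof (cases "norm v < \<delta>")
      case False
      have "?t \<le> 1"
        using gap assms(9) powr_mono2[of \<alpha> "y - h xb" 1] by simp
      then have "c' * ?t \<le> \<delta> * 1"
        using \<delta>(1) by (intro mult_mono) (auto simp: c'_def)
      with False show ?thesis by simp
    next
      case True
      have fx: "\<bar>f x - f xb\<bar> < ereal \<delta>0" "\<bar>f x - f xb\<bar> < ereal \<delta>1"
        using gap \<delta> by (simp_all add: y fxb)
      have xM: "x \<in> M"
        using ident[of x v] near fx(2) v True \<delta> by simp
      have xU: "x \<in> U" "x \<in> U0"
        using near(2) \<epsilon>1(2) by (auto simp: dist_norm norm_minus_commute)
      obtain r where r: "r > 0" "closed (M \<inter> cball x r)"
        using U0(4) xM xU by blast
      have D: "GDERIV h x :> G x"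
        using U(3) xU unfolding C2_with_gradient_on_def by blast
      have "norm (covariant_derivative M f x) \<le> norm v"
      proof (rule norm_covariant_derivative_le[OF r(2,1) xM _ U(1) xU(1) U(4) D])
        show "subspace (tangent_space M x)" using U0(3) xM xU by blast
        show "\<delta> - norm (x - xb) > 0" using near(3) by simp
        show "f z \<ge> f x + ereal (v \<bullet> (z - x) - \<rho> / 2 * (norm (z - x))\<^sup>2)"
          if "norm (z - x) < \<delta> - norm (x - xb)" for z
        proof (rule prox0)
          show "norm (z - xb) < \<delta>0"
            using that \<delta>(2) norm_triangle_ineq[of "z - x" "x - xb"] by simp
        qed (use near fx(1) v True \<delta> in simp_all)
      qed
      moreover have "c * ?t \<le> norm (covariant_derivative M f x)"
        using assms(11)[OF xM near(1) x(2)] gap by (simp add: y fxb)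
      moreover have "c' * ?t \<le> c * ?t"
        by (intro mult_right_mono) (auto simp: c'_def)
      ultimately show ?thesis by linarith
    qed
    then show ?thesis by (simp add: y fxb)
  qed
  have "\<forall>x. norm (x - xb) \<le> \<epsilon>' \<and> f xb < f x \<and> f x < f xb + ereal \<nu>'
      \<longrightarrow> edist_to 0 (subdiff f x) \<ge> ereal (c' * real_of_ereal (f x - f xb) powr \<alpha>)"
    unfolding edist_to_def using main by (auto intro!: INF_greatest)
  moreover have "c' > 0" "\<epsilon>' > 0" "ereal \<nu>' > 0"
    using assms(6-8) \<delta>(1) \<epsilon>1(1) by (auto simp: c'_def \<epsilon>'_def \<nu>'_def)
  moreover have "xb \<in> dom_subdiff f"
    using zero unfolding dom_subdiff_def by blast
  ultimately show ?thesis
    using assms(1,2,9,10) unfolding KL_property_def by blast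
qed

end
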